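(* Let $G$ be a torsion-free abelian group and let $R=\bigoplus_{n\in G}R_n$ be a $G$-graded commutative ring. Then every idempotent element of $R$ is contained in the base subring $R_0$, where $0$ is the identity element of $G$.
   Context: Rings have an identity. A $G$-graded ring is a ring $R$ with a decomposition $R=\bigoplus_{n\in G}R_n$ of its additive group into subgroups with $R_mR_n\subseteq R_{m+n}$ for all $m,n\in G$. *)

theory Defs
  imports "HOL-Algebra.Algebra"
begin

text \<open>
  Groups of \<open>HOL-Algebra\<close> are written multiplicatively. Thus \<open>m \<otimes>\<^bsub>G\<^esub> n\<close>, \<open>\<one>\<^bsub>G\<^esub>\<close> and
  \<open>g [^]\<^bsub>G\<^esub> k\<close> stand for \<open>m + n\<close>, \<open>0\<close> and \<open>k g\<close> in an additively written grading group,
  and the base subring is \<open>A \<one>\<^bsub>G\<^esub>\<close>.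
\<close>

definition torsion_free :: "('g, 'x) monoid_scheme \<Rightarrow> bool" where
  "torsion_free G \<longleftrightarrow>
     (\<forall>g \<in> carrier G. \<forall>k::nat. k > 0 \<longrightarrow> g [^]\<^bsub>G\<^esub> k = \<one>\<^bsub>G\<^esub> \<longrightarrow> g = \<one>\<^bsub>G\<^esub>)"

text \<open>
  The additive group of \<open>R\<close> is the internal direct sum of the family \<open>A\<close> indexed by \<open>I\<close>:
  every element is the sum of a unique finitely supported family of elements of the \<open>A i\<close>.
  Uniqueness is among functions on \<open>I\<close>, whence the extensional function space. The sum is
  taken over the support, since \<open>finsum\<close> is only meaningful over finite index sets.
\<close>

definition internal_direct_sum ::
    "('a, 'y) ring_scheme \<Rightarrow> 'g set \<Rightarrow> ('g \<Rightarrow> 'a set) \<Rightarrow> bool" where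
  "internal_direct_sum R I A \<longleftrightarrow>
     (\<forall>i \<in> I. additive_subgroup (A i) R) \<and>
     (\<forall>x \<in> carrier R. \<exists>!f. f \<in> (\<Pi>\<^sub>E i \<in> I. A i) \<and>
        finite {i \<in> I. f i \<noteq> \<zero>\<^bsub>R\<^esub>} \<and>
        x = (\<Oplus>\<^bsub>R\<^esub> i \<in> {i \<in> I. f i \<noteq> \<zero>\<^bsub>R\<^esub>}. f i))"

locale graded_ring = G: group G + R: ring R
  for G :: "('g, 'x) monoid_scheme" (structure)
    and R :: "('a, 'y) ring_scheme" (structure)
    and A :: "'g \<Rightarrow> 'a set" +
  assumes direct_sum: "internal_direct_sum R (carrier G) A"
    and mult_closed:
      "\<lbrakk>m \<in> carrier G; n \<in> carrier G; x \<in> A m; y \<in> A n\<rbrakk>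
        \<Longrightarrow> x \<otimes>\<^bsub>R\<^esub> y \<in> A (m \<otimes>\<^bsub>G\<^esub> n)"

end

theory Submission
  imports Defs
begin

text \<open>
  The group \<open>G\<close> can be totally ordered. If \<open>m\<close> is the largest positive degree in which \<open>e\<close> has a
  non-nilpotent component \<open>e\<^sub>m\<close>, then the component of \<open>e = e\<^sup>2\<close> in degree \<open>2m > m\<close> is \<open>e\<^sub>m\<^sup>2\<close>
  plus nilpotents, and it is nilpotent by the choice of \<open>m\<close>, a contradiction. By symmetry all
  components of non-zero degree are nilpotent, so \<open>e\<close> is congruent to \<open>e\<^sub>0\<close> modulo nilpotents.
  Lifting idempotents inside \<open>R\<^sub>0\<close> then gives \<open>e\<close> itself, because an idempotent is determined
  by its class modulo nilpotents.
\<close>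

section \<open>Total orders on torsion-free abelian groups\<close>

text \<open>This is the cone of elements above the identity in a translation-invariant total order:
  \<open>x\<close> lies below \<open>y\<close> when \<open>inv x \<otimes> y\<close> is in
  \<open>P\<close>. The order enters only through its cone.\<close>

definition total_cone :: "('g, 'x) monoid_scheme \<Rightarrow> 'g set \<Rightarrow> bool" where
  "total_cone G P \<longleftrightarrow> submonoid P G \<and> (\<forall>x \<in> P. inv\<^bsub>G\<^esub> x \<in> P \<longrightarrow> x = \<one>\<^bsub>G\<^esub>) \<and>
     (\<forall>x \<in> carrier G. x \<in> P \<or> inv\<^bsub>G\<^esub> x \<in> P)"

text \<open>Zorn's lemma gives a submonoid maximal among those that meet their inverses only in
  \<open>\<one>\<close>; torsion-freeness then forces it to be total.\<close>

lemma (in comm_group) total_cone_exists: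
  assumes "torsion_free G"
  obtains P where "total_cone G P"
proof -
  define C where "C = {P. submonoid P G \<and> (\<forall>x \<in> P. inv x \<in> P \<longrightarrow> x = \<one>)}"
  have "\<exists>M\<in>C. \<forall>N\<in>C. M \<subseteq> N \<longrightarrow> N = M"
  proof (rule subset_Zorn_nonempty)
    have "{\<one>} \<in> C" by (auto simp: C_def intro!: submonoid.intro)
    then show "C \<noteq> {}" by blast
  next
    fix D assume D: "D \<noteq> {}" "subset.chain C D"
    then have sub: "P \<in> C" if "P \<in> D" for P
      using that by (auto simp: subset_chain_def)
    \<comment> \<open>Closure and antisymmetry involve only two elements, which a chain always puts
      into one member.\<close>
    have two: "\<exists>P\<in>D. x \<in> P \<and> y \<in> P" if xy: "x \<in> \<Union>D" "y \<in> \<Union>D" for x y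
    proof -
      obtain P Q where "x \<in> P" "P \<in> D" "y \<in> Q" "Q \<in> D" using xy by blast
      moreover from this have "P \<subseteq> Q \<or> Q \<subseteq> P" using D(2) by (simp add: subset_chain_def)
      ultimately show ?thesis by blast
    qed
    have sm: "submonoid P G" if "P \<in> D" for P using sub[OF that] by (simp add: C_def)
    have "submonoid (\<Union>D) G"
    proof
      show "\<Union>D \<subseteq> carrier G" using submonoid.subset[OF sm] by blast
      show "\<one> \<in> \<Union>D" using submonoid.one_closed[OF sm] D(1) by blast
      show "x \<otimes> y \<in> \<Union>D" if "x \<in> \<Union>D" "y \<in> \<Union>D" for x y
        using two[OF that] submonoid.m_closed[OF sm] by blast
    qed
    moreover have "x = \<one>" if "x \<in> \<Union>D" "inv x \<in> \<Union>D" for x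
      using two[OF that] sub by (auto simp: C_def)
    ultimately show "\<Union>D \<in> C" by (simp add: C_def)
  qed
  then obtain M where "M \<in> C" and max: "\<And>N. N \<in> C \<Longrightarrow> M \<subseteq> N \<Longrightarrow> N = M" by blast
  then have anti: "\<And>x. x \<in> M \<Longrightarrow> inv x \<in> M \<Longrightarrow> x = \<one>" and "submonoid M G"
    by (auto simp: C_def)
  then interpret M: submonoid M G by simp
  have Mc: "x \<in> carrier G" if "x \<in> M" for x using that M.subset by blast
  have M_pow: "x [^] (k::nat) \<in> M" if "x \<in> M" for x k
    using that by (induction k) auto
  \<comment> \<open>By maximality \<open>g\<close> cannot be adjoined to \<open>M\<close>; what
    obstructs this is a positive power of \<open>inv g\<close> already in \<open>M\<close>.\<close>
  have pow_mem: "\<exists>k::nat. k > 0 \<and> (inv g) [^] k \<in> M" if g: "g \<in> carrier G" "g \<notin> M" for g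
  proof (rule ccontr)
    assume no: "\<not> ?thesis"
    \<comment> \<open>The submonoid generated by \<open>M\<close> and \<open>g\<close>; it turns out
      to lie in \<open>C\<close>, against maximality.\<close>
    define Q where "Q = {p \<otimes> g [^] (k::nat) | p k. p \<in> M}"
    have QI: "p \<otimes> g [^] k \<in> Q" if "p \<in> M" for p and k :: nat using that by (auto simp: Q_def)
    have "submonoid Q G"
    proof
      show "Q \<subseteq> carrier G" using Mc g by (auto simp: Q_def)
      show "\<one> \<in> Q" using QI[of \<one> 0] by simp
      fix x y assume "x \<in> Q" "y \<in> Q"
      then obtain p q and k l :: nat where pq: "p \<in> M" "q \<in> M"
        and xy: "x = p \<otimes> g [^] k" "y = q \<otimes> g [^] l" by (auto simp: Q_def)
      have "x \<otimes> y = (p \<otimes> q) \<otimes> g [^] (k + l)"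
        using Mc pq g by (simp add: xy nat_pow_mult[symmetric] m_ac)
      then show "x \<otimes> y \<in> Q" using QI pq by simp
    qed
    moreover have "x = \<one>" if x: "x \<in> Q" "inv x \<in> Q" for x
    proof -
      obtain p q and k l :: nat where pq: "p \<in> M" "q \<in> M"
        and xy: "x = p \<otimes> g [^] k" "inv x = q \<otimes> g [^] l" using x by (auto simp: Q_def)
      have xc: "x \<in> carrier G" using Mc pq g xy by simp
      have "(p \<otimes> q) \<otimes> g [^] (k + l) = (p \<otimes> g [^] k) \<otimes> (q \<otimes> g [^] l)"
        using Mc pq g by (simp add: nat_pow_mult[symmetric] m_ac)
      also have "\<dots> = x \<otimes> inv x" by (subst xy(2)) (simp only: xy(1))
      also have "\<dots> = \<one>" using xc by simp
      finally have "inv (g [^] (k + l)) = p \<otimes> q"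
        using Mc pq g by (intro inv_equality) auto
      then have "(inv g) [^] (k + l) \<in> M" using g pq by (simp add: nat_pow_inv)
      \<comment> \<open>A positive exponent would contradict \<open>no\<close>. Hence
        \<open>x\<close> and \<open>inv x\<close> are \<open>p\<close> and \<open>q\<close>, both in
        \<open>M\<close>.\<close>
      then have "k + l = 0" using no by auto
      then show "x = \<one>" using anti[of x] pq xy Mc by simp
    qed
    ultimately have "Q \<in> C" by (simp add: C_def)
    moreover have "M \<subseteq> Q" using QI[of _ 0] Mc by fastforce
    ultimately have "Q = M" by (rule max)
    then show False using QI[of \<one> 1] g by simp
  qed
  have "x \<in> M \<or> inv x \<in> M" if x: "x \<in> carrier G" for x
  proof (rule ccontr)
    assume no: "\<not> ?thesis"
    obtain k :: nat where k: "k > 0" "(inv x) [^] k \<in> M" using pow_mem[of x] x no by auto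
    obtain l :: nat where l: "l > 0" "x [^] l \<in> M" using pow_mem[of "inv x"] x no by auto
    \<comment> \<open>The product of the exponents serves both memberships, so a power of
      \<open>x\<close> and its inverse lie in \<open>M\<close>.\<close>
    have "x [^] (l * k) \<in> M" using M_pow[OF l(2), of k] x by (simp add: nat_pow_pow)
    moreover have "inv (x [^] (l * k)) \<in> M"
      using M_pow[OF k(2), of l] x by (simp add: nat_pow_pow nat_pow_inv mult.commute)
    ultimately have "x [^] (l * k) = \<one>" by (rule anti)
    moreover have "l * k > 0" using k l by simp
    ultimately have "x = \<one>" using assms x unfolding torsion_free_def by blast
    then show False using no by simp
  qed
  then have "total_cone G M" using anti \<open>submonoid M G\<close> unfolding total_cone_def by blast
  then show ?thesis by (rule that)
qed

text \<open>The opposite order: it lets results on positive degrees be applied to negative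
  ones.\<close>

lemma (in comm_group) total_cone_inv:
  assumes "total_cone G P"
  shows "total_cone G {x \<in> carrier G. inv x \<in> P}"
proof -
  interpret P: submonoid P G using assms by (simp add: total_cone_def)
  have "submonoid {x \<in> carrier G. inv x \<in> P} G"
    by standard (auto simp: inv_mult)
  then show ?thesis using assms P.subset by (fastforce simp: total_cone_def)
qed

section \<open>Nilpotent elements\<close>

definition nilradical :: "('a, 'y) ring_scheme \<Rightarrow> 'a set" where
  "nilradical R = {x \<in> carrier R. \<exists>n::nat. x [^]\<^bsub>R\<^esub> n = \<zero>\<^bsub>R\<^esub>}"

context cring
begin

lemma nat_pow_eq_zero_mono:
  assumes "x \<in> carrier R" "x [^] (m::nat) = \<zero>" "m \<le> n"
  shows "x [^] n = \<zero>"
proof -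
  have "x [^] n = x [^] m \<otimes> x [^] (n - m)" using nat_pow_mult[OF assms(1), of m "n - m"] assms(3) by simp
  then show ?thesis using assms by simp
qed

text \<open>This replaces the binomial expansion. Splitting one factor \<open>x \<oplus> y\<close>
  moves a unit of exponent from \<open>k\<close> to \<open>i\<close> or \<open>j\<close> and keeps
  the total; at \<open>k = 0\<close> one of the two powers vanishes. The case
  \<open>i = j = 0\<close> shows that sums of nilpotents are nilpotent.\<close>

lemma nilpotent_add:
  fixes m n i j k :: nat
  assumes x: "x \<in> carrier R" "x [^] m = \<zero>" and y: "y \<in> carrier R" "y [^] n = \<zero>"
    and "m + n \<le> i + j + k"
  shows "x [^] i \<otimes> y [^] j \<otimes> (x \<oplus> y) [^] k = \<zero>"
  using \<open>m + n \<le> i + j + k\<close>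
proof (induction k arbitrary: i j)
  case 0
  then have "m \<le> i \<or> n \<le> j" by linarith
  then have "x [^] i = \<zero> \<or> y [^] j = \<zero>" using nat_pow_eq_zero_mono x y by blast
  then show ?case using x y by auto
next
  case (Suc k)
  have "x [^] i \<otimes> y [^] j \<otimes> (x \<oplus> y) [^] Suc k =
      x [^] Suc i \<otimes> y [^] j \<otimes> (x \<oplus> y) [^] k \<oplus> x [^] i \<otimes> y [^] Suc j \<otimes> (x \<oplus> y) [^] k"
    using x(1) y(1) by (simp add: l_distr r_distr m_ac)
  also have "\<dots> = \<zero>" using Suc.IH[of "Suc i" j] Suc.IH[of i "Suc j"] Suc.prems by simp
  finally show ?case .
qed

lemma ideal_nilradical: "ideal (nilradical R) R"
proof -
  have mult: "a \<otimes> x \<in> nilradical R" if "a \<in> nilradical R" "x \<in> carrier R" for a x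
    using that by (auto simp: nilradical_def nat_pow_distrib) (metis l_null nat_pow_closed)
  have add: "a \<oplus> b \<in> nilradical R" if ab: "a \<in> nilradical R" "b \<in> nilradical R" for a b
  proof -
    obtain m n :: nat where "a \<in> carrier R" "a [^] m = \<zero>" "b \<in> carrier R" "b [^] n = \<zero>"
      using ab unfolding nilradical_def by blast
    then show ?thesis using nilpotent_add[of a m b n 0 0 "m + n"] by (auto simp: nilradical_def)
  qed
  have neg: "\<ominus> a \<in> nilradical R" if "a \<in> nilradical R" for a
  proof -
    have "a \<in> carrier R" using that by (simp add: nilradical_def)
    then show ?thesis using mult[OF that, of "\<ominus> \<one>"] by (simp add: r_minus)
  qed
  have "\<zero> [^] (1::nat) = \<zero>" by simp
  then have zero: "\<zero> \<in> nilradical R" unfolding nilradical_def by blast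
  have "subgroup (nilradical R) (add_monoid R)"
  proof (rule add.subgroupI)
    show "nilradical R \<subseteq> carrier R" by (auto simp: nilradical_def)
    show "nilradical R \<noteq> {}" using zero by blast
  qed (use neg add in \<open>auto simp: a_inv_def\<close>)
  then show ?thesis
  proof (rule idealI[OF ring_axioms])
    fix a x assume ax: "a \<in> nilradical R" "x \<in> carrier R"
    then show "a \<otimes> x \<in> nilradical R" by (rule mult)
    with ax show "x \<otimes> a \<in> nilradical R" by (simp add: nilradical_def m_comm)
  qed
qed

lemma square_in_nilradicalD:
  assumes "x \<in> carrier R" "x \<otimes> x \<in> nilradical R"
  shows "x \<in> nilradical R"
proof -
  obtain n :: nat where "(x \<otimes> x) [^] n = \<zero>" using assms by (auto simp: nilradical_def)
  then have "x [^] (n + n) = \<zero>" using assms by (simp add: nat_pow_distrib nat_pow_mult)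
  then show ?thesis using assms by (auto simp: nilradical_def)
qed

end

lemma (in ideal) finsum_mem:
  assumes "\<And>t. t \<in> T \<Longrightarrow> f t \<in> I"
  shows "(\<Oplus>t\<in>T. f t) \<in> I"
  using assms
proof (induction T rule: infinite_finite_induct)
  case (insert t T)
  then have "f \<in> T \<rightarrow> carrier R" "f t \<in> carrier R" using a_subset by auto
  then show ?case using insert by simp
qed auto

section \<open>Lifting idempotents modulo nilpotents\<close>

lemma (in cring) mult_pow_cong:
  assumes "a \<in> carrier R" "b \<in> carrier R" "c \<in> carrier R" "a \<otimes> b = a \<otimes> c"
  shows "a \<otimes> b [^] (k::nat) = a \<otimes> c [^] k"
proof (induction k)
  case (Suc k)
  have "a \<otimes> b [^] Suc k = a \<otimes> b [^] k \<otimes> b" using assms by (simp add: m_assoc)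
  \<comment> \<open>Commutativity brings \<open>a\<close> next to the last \<open>b\<close>, where
    the hypothesis exchanges \<open>b\<close> for \<open>c\<close>.\<close>
  also have "\<dots> = c [^] k \<otimes> (a \<otimes> b)"
    unfolding Suc using assms(1-3) by (simp add: m_ac)
  also have "\<dots> = c [^] k \<otimes> (a \<otimes> c)" by (simp only: assms(4))
  also have "\<dots> = a \<otimes> c [^] Suc k" using assms by (simp add: m_ac)
  finally show ?case .
qed simp

text \<open>
  On the factor \<open>eR\<close> the element \<open>x\<close> is \<open>1\<close> up to nilpotents, so \<open>w = 1 - (1 - x)\<^sup>n\<close> is \<open>1\<close> there;
  on \<open>(1 - e)R\<close> it is nilpotent, so its multiple \<open>w\<close> has a vanishing power there.
  Hence a power of \<open>w\<close> is \<open>e\<close>. Since \<open>w\<close> is a polynomial in \<open>x\<close> without constant term,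
  \<open>S\<close> need not contain \<open>1\<close>.
\<close>

lemma (in cring) idempotent_mem_if_nilpotent_diff:
  assumes S: "additive_subgroup S R" and mult: "\<And>x y. x \<in> S \<Longrightarrow> y \<in> S \<Longrightarrow> x \<otimes> y \<in> S"
    and e: "e \<in> carrier R" "e \<otimes> e = e"
    and x: "x \<in> S" "x \<ominus> e \<in> nilradical R"
  shows "e \<in> S"
proof -
  interpret S: additive_subgroup S R by (rule S)
  interpret N: ideal "nilradical R" R by (rule ideal_nilradical)
  have Sc: "x \<in> carrier R" if "x \<in> S" for x using that S.a_subset by blast
  have xc: "x \<in> carrier R" using x Sc by blast
  obtain m :: nat where m: "(x \<ominus> e) [^] m = \<zero>" using x(2) unfolding nilradical_def by blast
  \<comment> \<open>The exponent \<open>m\<close> is for the factor of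
    \<open>\<one> \<ominus> e\<close>, and \<open>n\<close> for the factor of \<open>e\<close>,
    where the difference occurs with the opposite sign.\<close>
  have "e \<ominus> x = \<ominus> (x \<ominus> e)" using e xc by (simp add: minus_eq minus_add a_comm)
  then have "e \<ominus> x \<in> nilradical R" using x N.a_inv_closed by simp
  then obtain n :: nat where n: "(e \<ominus> x) [^] n = \<zero>" unfolding nilradical_def by blast
  define f where "f = \<one> \<ominus> e"
  have f: "f \<in> carrier R" "e \<oplus> f = \<one>" "f \<otimes> e = \<zero>"
    using e by (simp_all add: f_def minus_eq l_distr l_minus r_neg a_lcomm[of e \<one>])
  \<comment> \<open>Two facts are carried along: \<open>w\<close> stays in \<open>S\<close>, and
    \<open>w\<close> is a multiple of \<open>x\<close>, so that its powers vanish where those of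
    \<open>x\<close> do.\<close>
  have "\<exists>w\<in>S. \<exists>p\<in>carrier R. w = x \<otimes> p \<and> (\<one> \<ominus> x) [^] k = \<one> \<ominus> w" for k :: nat
  proof (induction k)
    case 0
    show ?case by (intro bexI[of _ \<zero>]) (use xc in \<open>auto simp: minus_eq\<close>)
  next
    case (Suc k)
    then obtain w p where w: "w \<in> S" "p \<in> carrier R" "w = x \<otimes> p" "(\<one> \<ominus> x) [^] k = \<one> \<ominus> w"
      by blast
    have wc: "w \<in> carrier R" using w Sc by blast
    \<comment> \<open>Expanding \<open>(\<one> \<ominus> w) \<otimes> (\<one> \<ominus> x)\<close>
      dictates this successor of \<open>w\<close>; its cofactor is
      \<open>p \<oplus> (\<one> \<ominus> w)\<close>.\<close>
    have "w \<oplus> (x \<ominus> x \<otimes> w) \<in> S" using w x mult by (simp add: minus_eq)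
    moreover have "w \<oplus> (x \<ominus> x \<otimes> w) = x \<otimes> (p \<oplus> (\<one> \<ominus> w))"
      using w(2,3) xc wc by (simp add: minus_eq r_distr r_minus)
    moreover have "(\<one> \<ominus> w) \<otimes> (\<one> \<ominus> x) = \<one> \<ominus> (w \<oplus> (x \<ominus> x \<otimes> w))"
      using xc wc by (simp add: minus_eq l_distr r_distr l_minus r_minus minus_add a_ac m_comm)
    ultimately show ?case using w wc by (metis nat_pow_Suc a_closed minus_closed one_closed)
  qed
  from this[of n] obtain w p where w: "w \<in> S" "p \<in> carrier R" "w = x \<otimes> p"
    and pow: "(\<one> \<ominus> x) [^] n = \<one> \<ominus> w" by blast
  have wc: "w \<in> carrier R" using w Sc by blast
  \<comment> \<open>Under multiplication by \<open>e\<close>, the nilpotent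
    \<open>e \<ominus> x\<close> may stand for \<open>\<one> \<ominus> x\<close>, because
    \<open>e\<close> is idempotent.\<close>
  have "e \<otimes> (\<one> \<ominus> x) = e \<otimes> (e \<ominus> x)" using e xc by (simp add: minus_eq r_distr)
  then have "e \<otimes> (\<one> \<ominus> x) [^] n = e \<otimes> (e \<ominus> x) [^] n"
    using e xc by (intro mult_pow_cong) auto
  then have "e \<otimes> (\<one> \<ominus> w) = \<zero>" using e xc n by (simp add: pow)
  then have "e \<ominus> e \<otimes> w = \<zero>" using e wc by (simp add: minus_eq r_distr r_minus)
  then have "e \<otimes> w = e \<otimes> \<one>" using e wc by simp
  \<comment> \<open>\<open>Suc m\<close> instead of \<open>m\<close> keeps the exponent positive,
    since \<open>S\<close> may lack the unit and hence zeroth powers.\<close>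
  then have ew: "e \<otimes> w [^] Suc m = e" using mult_pow_cong[of e w \<one> "Suc m"] e wc by simp
  \<comment> \<open>On the complementary factor \<open>e\<close> is killed, so there
    \<open>x\<close> agrees with the nilpotent \<open>x \<ominus> e\<close>.\<close>
  have "f \<otimes> x = f \<otimes> (x \<ominus> e)" using e f xc by (simp add: minus_eq r_distr r_minus)
  then have "f \<otimes> x [^] Suc m = f \<otimes> (x \<ominus> e) [^] Suc m"
    using e f xc by (intro mult_pow_cong) auto
  then have "f \<otimes> x [^] Suc m = \<zero>" using e f xc m by simp
  moreover have "f \<otimes> w [^] Suc m = f \<otimes> x [^] Suc m \<otimes> p [^] Suc m"
    using f xc w(2) unfolding w(3) by (simp only: nat_pow_distrib m_assoc nat_pow_closed)
  ultimately have "f \<otimes> w [^] Suc m = \<zero>" using w by (simp del: nat_pow_Suc)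
  moreover have "w [^] Suc m = e \<otimes> w [^] Suc m \<oplus> f \<otimes> w [^] Suc m"
    using e f wc by (simp only: l_distr[symmetric] nat_pow_closed l_one)
  ultimately have "w [^] Suc m = e" using ew e by (simp del: nat_pow_Suc)
  moreover have "w [^] Suc k \<in> S" for k :: nat
  proof (induction k)
    case (Suc k)
    then show ?case using mult[OF Suc w(1)] by simp
  qed (use w(1) wc in simp)
  ultimately show ?thesis by (simp only: flip: \<open>w [^] Suc m = e\<close>)
qed

section \<open>Homogeneous components\<close>

context graded_ring
begin

lemma component_subgroup: "g \<in> carrier G \<Longrightarrow> additive_subgroup (A g) R"
  using direct_sum by (simp add: internal_direct_sum_def)

lemma component_carrier: "g \<in> carrier G \<Longrightarrow> x \<in> A g \<Longrightarrow> x \<in> carrier R"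
  using additive_subgroup.a_subset[OF component_subgroup] by blast

lemma zero_in_component: "g \<in> carrier G \<Longrightarrow> \<zero>\<^bsub>R\<^esub> \<in> A g"
  using additive_subgroup.zero_closed[OF component_subgroup] by blast

lemma component_finsum:
  assumes "g \<in> carrier G" "\<And>t. t \<in> T \<Longrightarrow> f t \<in> A g"
  shows "(\<Oplus>\<^bsub>R\<^esub>t\<in>T. f t) \<in> A g"
  using assms(2)
proof (induction T rule: infinite_finite_induct)
  case (insert t T)
  then have "f \<in> T \<rightarrow> carrier R" "f t \<in> carrier R" using assms(1) component_carrier by auto
  then show ?case
    using insert additive_subgroup.a_closed[OF component_subgroup[OF assms(1)]] by simp
qed (auto simp: zero_in_component assms)

text \<open>Extension by zero off a finite support replaces the extensional family, so that sums may
  run over larger index sets.\<close>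

lemma homogeneous_decomposition:
  assumes "x \<in> carrier R"
  obtains T f where "finite T" "T \<subseteq> carrier G" "\<And>g. g \<in> carrier G \<Longrightarrow> f g \<in> A g"
    "\<And>g. g \<notin> T \<Longrightarrow> f g = \<zero>\<^bsub>R\<^esub>" "x = (\<Oplus>\<^bsub>R\<^esub>g\<in>T. f g)"
proof -
  obtain f where f: "f \<in> (\<Pi>\<^sub>E i \<in> carrier G. A i)"
    and fin: "finite {i \<in> carrier G. f i \<noteq> \<zero>\<^bsub>R\<^esub>}"
    and x: "x = (\<Oplus>\<^bsub>R\<^esub> i \<in> {i \<in> carrier G. f i \<noteq> \<zero>\<^bsub>R\<^esub>}. f i)"
    using direct_sum assms unfolding internal_direct_sum_def by blast
  let ?T = "{i \<in> carrier G. f i \<noteq> \<zero>\<^bsub>R\<^esub>}"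
  let ?f = "\<lambda>g. if g \<in> ?T then f g else \<zero>\<^bsub>R\<^esub>"
  have "x = (\<Oplus>\<^bsub>R\<^esub>g\<in>?T. ?f g)"
    unfolding x using f component_carrier by (intro R.finsum_cong') (auto simp: PiE_iff)
  then show ?thesis
    using f fin by (intro that[of ?T ?f]) (auto simp: zero_in_component)
qed

text \<open>Both families are extended by zero from \<open>T\<close> to all of \<open>G\<close>; the
  uniqueness in \<open>internal_direct_sum\<close> then applies to the extensions.\<close>

lemma finsum_components_unique:
  assumes T: "finite T" "T \<subseteq> carrier G"
    and u: "\<And>t. t \<in> T \<Longrightarrow> u t \<in> A t" and v: "\<And>t. t \<in> T \<Longrightarrow> v t \<in> A t"
    and eq: "(\<Oplus>\<^bsub>R\<^esub>t\<in>T. u t) = (\<Oplus>\<^bsub>R\<^esub>t\<in>T. v t)"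
    and "t \<in> T"
  shows "u t = v t"
proof -
  define ext where "ext = (\<lambda>w. \<lambda>g\<in>carrier G. if g \<in> T then w g else \<zero>\<^bsub>R\<^esub>)"
  let ?P = "\<lambda>f. f \<in> (\<Pi>\<^sub>E i \<in> carrier G. A i) \<and> finite {i \<in> carrier G. f i \<noteq> \<zero>\<^bsub>R\<^esub>} \<and>
    (\<Oplus>\<^bsub>R\<^esub>t\<in>T. u t) = (\<Oplus>\<^bsub>R\<^esub> i \<in> {i \<in> carrier G. f i \<noteq> \<zero>\<^bsub>R\<^esub>}. f i)"
  have P: "?P (ext w)" if w: "\<And>t. t \<in> T \<Longrightarrow> w t \<in> A t"
    and sum: "(\<Oplus>\<^bsub>R\<^esub>t\<in>T. u t) = (\<Oplus>\<^bsub>R\<^esub>t\<in>T. w t)" for w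
  proof -
    have wc: "w t \<in> carrier R" if "t \<in> T" for t using w that T component_carrier by blast
    have sub: "{i \<in> carrier G. ext w i \<noteq> \<zero>\<^bsub>R\<^esub>} \<subseteq> T" by (auto simp: ext_def)
    then have fin: "finite {i \<in> carrier G. ext w i \<noteq> \<zero>\<^bsub>R\<^esub>}" using T finite_subset by blast
    have "(\<Oplus>\<^bsub>R\<^esub>t\<in>T. w t) = (\<Oplus>\<^bsub>R\<^esub> i \<in> {i \<in> carrier G. ext w i \<noteq> \<zero>\<^bsub>R\<^esub>}. ext w i)"
      using T wc fin sub by (intro R.add.finprod_mono_neutral_cong) (auto simp: ext_def)
    then show ?thesis using w fin sum by (auto simp: ext_def zero_in_component)
  qed
  have "(\<Oplus>\<^bsub>R\<^esub>t\<in>T. u t) \<in> carrier R"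
    using u T component_carrier by (intro R.finsum_closed) blast
  then have "\<exists>!f. ?P f" using direct_sum unfolding internal_direct_sum_def by blast
  moreover have "?P (ext u)" using u by (intro P) auto
  moreover have "?P (ext v)" using v eq by (intro P) auto
  ultimately have "ext u = ext v" by blast
  then have "ext u t = ext v t" by simp
  then show ?thesis using \<open>t \<in> T\<close> T by (auto simp: ext_def split: if_splits)
qed

section \<open>Comparing an idempotent with its square degree by degree\<close>

lemma component_square:
  assumes T: "finite T" "T \<subseteq> carrier G"
    and f: "\<And>g. g \<in> carrier G \<Longrightarrow> f g \<in> A g" and f0: "\<And>g. g \<notin> T \<Longrightarrow> f g = \<zero>\<^bsub>R\<^esub>"
    and e: "e = (\<Oplus>\<^bsub>R\<^esub>g\<in>T. f g)" "e \<otimes>\<^bsub>R\<^esub> e = e"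
    and c: "c \<in> carrier G"
  shows "f c = (\<Oplus>\<^bsub>R\<^esub>p\<in>{(a, b) \<in> T \<times> T. a \<otimes> b = c}. (\<lambda>(a, b). f a \<otimes>\<^bsub>R\<^esub> f b) p)"
proof -
  \<comment> \<open>A finite set of degrees over which both \<open>e\<close> and its square can be
    expanded; \<open>c\<close> is inserted so that the comparison also covers degrees where both
    sides vanish.\<close>
  define U where "U = insert c (T \<union> (\<lambda>(a, b). a \<otimes> b) ` (T \<times> T))"
  define Q where "Q = (\<lambda>c. {(a, b) \<in> T \<times> T. a \<otimes> b = c})"
  define F where "F = (\<lambda>(a, b). f a \<otimes>\<^bsub>R\<^esub> f b)"
  have fc: "f g \<in> carrier R" if "g \<in> T" for g using that T f component_carrier by blast
  have U: "finite U" "U \<subseteq> carrier G" using T c by (auto simp: U_def)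
  have Qfin: "finite (Q c)" for c
    by (rule finite_subset[of _ "T \<times> T"]) (use T in \<open>auto simp: Q_def\<close>)
  have Fc: "F p \<in> carrier R" if "p \<in> T \<times> T" for p using that fc by (auto simp: F_def)
  have FA: "(\<Oplus>\<^bsub>R\<^esub>p\<in>Q c. F p) \<in> A c" if "c \<in> carrier G" for c
    using that T f mult_closed by (intro component_finsum) (auto simp: Q_def F_def subset_iff)
  have "(\<Oplus>\<^bsub>R\<^esub>g\<in>U. f g) = (\<Oplus>\<^bsub>R\<^esub>g\<in>T. f g)"
    using U T fc f0 f component_carrier
    by (intro R.add.finprod_mono_neutral_cong) (auto simp: U_def)
  also have "\<dots> = (\<Oplus>\<^bsub>R\<^esub>a\<in>T. f a) \<otimes>\<^bsub>R\<^esub> (\<Oplus>\<^bsub>R\<^esub>b\<in>T. f b)" using e by simp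
  also have "\<dots> = (\<Oplus>\<^bsub>R\<^esub>a\<in>T. f a \<otimes>\<^bsub>R\<^esub> (\<Oplus>\<^bsub>R\<^esub>b\<in>T. f b))"
    using T fc by (intro R.finsum_ldistr R.finsum_closed) auto
  also have "\<dots> = (\<Oplus>\<^bsub>R\<^esub>a\<in>T. \<Oplus>\<^bsub>R\<^esub>p\<in>{a} \<times> T. F p)"
  proof (intro R.finsum_cong' refl)
    fix a assume a: "a \<in> T"
    have "f a \<otimes>\<^bsub>R\<^esub> (\<Oplus>\<^bsub>R\<^esub>b\<in>T. f b) = (\<Oplus>\<^bsub>R\<^esub>b\<in>T. F (a, b))"
      using T fc a by (simp add: F_def R.finsum_rdistr Pi_iff)
    also have "\<dots> = (\<Oplus>\<^bsub>R\<^esub>p\<in>Pair a ` T. F p)"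
      using Fc a by (intro R.finsum_reindex[symmetric]) (auto simp: inj_on_def)
    also have "Pair a ` T = {a} \<times> T" by auto
    finally show "f a \<otimes>\<^bsub>R\<^esub> (\<Oplus>\<^bsub>R\<^esub>b\<in>T. f b) = (\<Oplus>\<^bsub>R\<^esub>p\<in>{a} \<times> T. F p)" .
  qed (use Fc in \<open>auto intro!: R.finsum_closed\<close>)
  also have "\<dots> = (\<Oplus>\<^bsub>R\<^esub>p\<in>(\<Union>a\<in>T. {a} \<times> T). F p)"
    using T Fc by (intro R.add.finprod_UN_disjoint[symmetric]) (auto simp: pairwise_def disjnt_def)
  \<comment> \<open>The pairs, so far grouped by first entry, are regrouped by the degree of their
    product.\<close>
  also have "(\<Union>a\<in>T. {a} \<times> T) = (\<Union>c\<in>U. Q c)" by (auto simp: U_def Q_def)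
  also have "(\<Oplus>\<^bsub>R\<^esub>p\<in>(\<Union>c\<in>U. Q c). F p) = (\<Oplus>\<^bsub>R\<^esub>c\<in>U. \<Oplus>\<^bsub>R\<^esub>p\<in>Q c. F p)"
    using U Qfin Fc
    by (intro R.add.finprod_UN_disjoint) (auto simp: pairwise_def disjnt_def Q_def)
  finally have "f c = (\<Oplus>\<^bsub>R\<^esub>p\<in>Q c. F p)"
    using U FA f by (intro finsum_components_unique[of U f]) (auto simp: U_def)
  then show ?thesis by (simp add: Q_def F_def)
qed

text \<open>For the largest bad degree \<open>m\<close>, every pair of degrees with product
  \<open>m \<otimes> m\<close> other than \<open>(m, m)\<close> has an entry above \<open>m\<close>.
  The cone \<open>P\<close> is arbitrary, so the opposite order is covered as well.\<close>

lemma positive_component_nilpotent: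
  assumes comm: "comm_group G" "cring R" and P: "total_cone G P"
    and T: "finite T" "T \<subseteq> carrier G"
    and f: "\<And>g. g \<in> carrier G \<Longrightarrow> f g \<in> A g" and f0: "\<And>g. g \<notin> T \<Longrightarrow> f g = \<zero>\<^bsub>R\<^esub>"
    and e: "e = (\<Oplus>\<^bsub>R\<^esub>g\<in>T. f g)" "e \<otimes>\<^bsub>R\<^esub> e = e"
    and g: "g \<in> P" "g \<noteq> \<one>"
  shows "f g \<in> nilradical R"
proof (rule ccontr)
  assume non: "f g \<notin> nilradical R"
  interpret comm_group G by (rule comm)
  interpret R: cring R by (rule comm)
  interpret P: submonoid P G using P by (simp add: total_cone_def)
  interpret N: ideal "nilradical R" R by (rule R.ideal_nilradical)
  have anti: "x = \<one>" if "x \<in> P" "inv x \<in> P" for x using P that by (simp add: total_cone_def)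
  have total: "x \<in> P \<or> inv x \<in> P" if "x \<in> carrier G" for x
    using P that by (simp add: total_cone_def)
  have Pc: "x \<in> carrier G" if "x \<in> P" for x using that P.subset by blast
  \<comment> \<open>Strictness comes from antisymmetry: a product equal to \<open>\<one>\<close>
    would make \<open>y\<close> the inverse of \<open>x\<close>.\<close>
  have pos: "x \<otimes> y \<in> P - {\<one>}" if "x \<in> P - {\<one>}" "y \<in> P" for x y
  proof -
    have "x \<otimes> y \<noteq> \<one>"
    proof
      assume "x \<otimes> y = \<one>"
      then have "inv x = y" using that Pc by (intro G.inv_equality) (auto simp: m_comm)
      then show False using anti that by auto
    qed
    then show ?thesis using that by simp
  qed
  define less where "less = (\<lambda>a b. inv a \<otimes> b \<in> P - {\<one>})"
  \<comment> \<open>The bad degrees; they are finite in number because \<open>T\<close> is, so a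
    largest one exists.\<close>
  define S where "S = {c \<in> T. c \<in> P - {\<one>} \<and> f c \<notin> nilradical R}"
  have "f g \<noteq> \<zero>\<^bsub>R\<^esub>" using non N.zero_closed by metis
  then have "g \<in> S" using g non f0 by (auto simp: S_def)
  moreover have "finite S" using T by (simp add: S_def)
  moreover have "transp_on S less"
  proof (rule transp_onI)
    fix x y z assume xyz: "x \<in> S" "y \<in> S" "z \<in> S" "less x y" "less y z"
    then have "(inv x \<otimes> y) \<otimes> (inv y \<otimes> z) \<in> P - {\<one>}" by (simp only: pos less_def DiffD1)
    moreover have "(inv x \<otimes> y) \<otimes> (inv y \<otimes> z) = inv x \<otimes> z"
    proof -
      have c: "x \<in> carrier G" "y \<in> carrier G" "z \<in> carrier G" using xyz T by (auto simp: S_def)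
      then have "(inv x \<otimes> y) \<otimes> (inv y \<otimes> z) = inv x \<otimes> ((y \<otimes> inv y) \<otimes> z)"
        by (simp only: G.m_assoc G.m_closed G.inv_closed)
      then show ?thesis using c by simp
    qed
    ultimately show "less x z" by (simp add: less_def)
  qed
  moreover have "asymp_on S less"
  proof (rule asymp_onI)
    fix x y assume xy: "x \<in> S" "y \<in> S" "less x y"
    then have "inv (inv x \<otimes> y) = inv y \<otimes> x" using T by (simp add: S_def subset_iff G.inv_mult_group)
    then show "\<not> less y x" using anti[of "inv x \<otimes> y"] xy by (auto simp: less_def)
  qed
  ultimately obtain m where m: "m \<in> S" and max: "\<And>x. x \<in> S \<Longrightarrow> x \<noteq> m \<Longrightarrow> \<not> less m x"
    using Finite_Set.bex_max_element[of S less] by blast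
  have mP: "m \<in> P - {\<one>}" "m \<in> T" and mc: "m \<in> carrier G" and fm: "f m \<notin> nilradical R"
    using m T by (auto simp: S_def)
  have fc: "f x \<in> carrier R" if "x \<in> carrier G" for x using that f component_carrier by blast
  \<comment> \<open>Anything above \<open>m\<close> is again positive, so a non-nilpotent component
    there would put its degree into \<open>S\<close>, against the choice of
    \<open>m\<close>.\<close>
  have above: "f x \<in> nilradical R" if x: "x \<in> carrier G" "less m x" for x
  proof (rule ccontr)
    assume no: "f x \<notin> nilradical R"
    then have "f x \<noteq> \<zero>\<^bsub>R\<^esub>" using N.zero_closed by metis
    then have "x \<in> T" using f0 by blast
    have "x = m \<otimes> (inv m \<otimes> x)" using x mc by (simp add: G.m_assoc[symmetric])
    then have "x \<in> P - {\<one>}" using pos[of m "inv m \<otimes> x"] mP x by (simp add: less_def)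
    then have "x \<in> S" using no \<open>x \<in> T\<close> by (simp add: S_def)
    moreover have "x \<noteq> m" using x mc by (auto simp: less_def)
    ultimately show False using max x by blast
  qed
  let ?Q = "{(a, b) \<in> T \<times> T. a \<otimes> b = m \<otimes> m}"
  let ?F = "\<lambda>(a, b). f a \<otimes>\<^bsub>R\<^esub> f b"
  have other: "?F p \<in> nilradical R" if p: "p \<in> ?Q - {(m, m)}" for p
  proof -
    obtain a b where ab: "p = (a, b)" "a \<in> carrier G" "b \<in> carrier G" "a \<otimes> b = m \<otimes> m"
      using p T by auto
    \<comment> \<open>The offsets of \<open>a\<close> and \<open>b\<close> from \<open>m\<close> are
      mutually inverse; unless both are trivial, totality makes one of them positive.\<close>
    have swap: "inv m \<otimes> b = inv (inv m \<otimes> a)"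
    proof -
      have "(inv m \<otimes> b) \<otimes> (inv m \<otimes> a) = inv m \<otimes> inv m \<otimes> (a \<otimes> b)"
        using ab(2,3) mc by (simp add: m_ac)
      also have "\<dots> = inv m \<otimes> inv m \<otimes> (m \<otimes> m)" using ab by simp
      also have "\<dots> = (inv m \<otimes> m) \<otimes> (inv m \<otimes> m)" using mc by (simp only: m_ac G.inv_closed G.m_closed)
      also have "\<dots> = \<one>" using mc by simp
      finally show ?thesis using ab mc by (intro G.inv_equality[symmetric]) auto
    qed
    have "inv m \<otimes> a \<noteq> \<one>"
    proof
      assume 1: "inv m \<otimes> a = \<one>"
      then have "inv m \<otimes> b = \<one>" using swap by simp
      with 1 have "a = m" "b = m" using ab(2,3) mc
        by (metis G.inv_solve_left G.r_one G.one_closed)+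
      then show False using p ab by simp
    qed
    then have "less m a \<or> less m b"
      using total[of "inv m \<otimes> a"] swap ab mc by (auto simp: less_def)
    then show ?thesis
      using above ab fc N.I_l_closed N.I_r_closed by auto
  qed
  have mm: "m \<otimes> m \<in> carrier G" using mc by simp
  \<comment> \<open>The offset of \<open>m \<otimes> m\<close> from \<open>m\<close> is
    \<open>m\<close> itself, which is positive.\<close>
  have "less m (m \<otimes> m)" using mc mP by (simp add: less_def G.m_assoc[symmetric])
  then have nil: "f (m \<otimes> m) \<in> nilradical R" using above mm by blast
  have decomp: "f (m \<otimes> m) = f m \<otimes>\<^bsub>R\<^esub> f m \<oplus>\<^bsub>R\<^esub> (\<Oplus>\<^bsub>R\<^esub>p\<in>?Q - {(m, m)}. ?F p)"
  proof -
    have fin: "finite (?Q - {(m, m)})" by (rule finite_subset[of _ "T \<times> T"]) (use T in auto)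
    have "?Q = insert (m, m) (?Q - {(m, m)})" using mP by auto
    then have "f (m \<otimes> m) = (\<Oplus>\<^bsub>R\<^esub>p\<in>insert (m, m) (?Q - {(m, m)}). ?F p)"
      using component_square[OF T f f0 e mm] by simp
    also have "\<dots> = ?F (m, m) \<oplus>\<^bsub>R\<^esub> (\<Oplus>\<^bsub>R\<^esub>p\<in>?Q - {(m, m)}. ?F p)"
      using fin T fc mc by (intro R.finsum_insert) (auto simp: subset_iff)
    finally show ?thesis by simp
  qed
  have "f m \<otimes>\<^bsub>R\<^esub> f m \<in> nilradical R"
  proof -
    define r where "r = (\<Oplus>\<^bsub>R\<^esub>p\<in>?Q - {(m, m)}. ?F p)"
    have r: "r \<in> nilradical R" unfolding r_def by (rule N.finsum_mem) (rule other)
    then have "r \<in> carrier R" using N.a_subset by blast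
    then have "f m \<otimes>\<^bsub>R\<^esub> f m = (f m \<otimes>\<^bsub>R\<^esub> f m \<oplus>\<^bsub>R\<^esub> r) \<oplus>\<^bsub>R\<^esub> \<ominus>\<^bsub>R\<^esub> r"
      using fc[OF mc] by (simp add: R.a_assoc R.r_neg)
    also have "\<dots> = f (m \<otimes> m) \<oplus>\<^bsub>R\<^esub> \<ominus>\<^bsub>R\<^esub> r" by (simp only: decomp r_def)
    also have "\<dots> \<in> nilradical R" using nil r by (intro N.a_closed N.a_inv_closed)
    finally show ?thesis .
  qed
  then show False using R.square_in_nilradicalD fm fc mc by blast
qed

end

section \<open>From the component of degree zero to the idempotent\<close>

theorem theorem6p1:
  fixes G :: "('g, 'x) monoid_scheme"
    and R :: "('a, 'y) ring_scheme"
    and A :: "'g \<Rightarrow> 'a set"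
    and e :: 'a
  assumes "comm_group G"
    and "torsion_free G"
    and "cring R"
    and "graded_ring G R A"
    and "e \<in> carrier R"
    and "e \<otimes>\<^bsub>R\<^esub> e = e"
  shows "e \<in> A \<one>\<^bsub>G\<^esub>"
proof -
  interpret comm_group G by (rule assms)
  interpret R: cring R by (rule assms)
  interpret graded_ring G R A by (rule assms)
  interpret N: ideal "nilradical R" R by (rule R.ideal_nilradical)
  obtain P where P: "total_cone G P" using total_cone_exists assms(2) by blast
  obtain T f where T: "finite T" "T \<subseteq> carrier G"
    and f: "\<And>g. g \<in> carrier G \<Longrightarrow> f g \<in> A g" "\<And>g. g \<notin> T \<Longrightarrow> f g = \<zero>\<^bsub>R\<^esub>"
    and e: "e = (\<Oplus>\<^bsub>R\<^esub>g\<in>T. f g)"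
    using homogeneous_decomposition[OF assms(5)] by metis
  have nil: "f g \<in> nilradical R" if g: "g \<in> carrier G" "g \<noteq> \<one>\<^bsub>G\<^esub>" for g
  proof (cases "g \<in> P")
    case True
    then show ?thesis
      using positive_component_nilpotent[OF assms(1,3) P T f e assms(6)] g by blast
  next
    case False
    \<comment> \<open>A negative degree is positive for the opposite order.\<close>
    then have "inv\<^bsub>G\<^esub> g \<in> P" using P g by (auto simp: total_cone_def)
    then show ?thesis
      using positive_component_nilpotent[OF assms(1,3) total_cone_inv[OF P] T f e assms(6)] g
      by blast
  qed
  define n where "n = (\<Oplus>\<^bsub>R\<^esub>g\<in>T - {\<one>\<^bsub>G\<^esub>}. f g)"
  have fc: "f g \<in> carrier R" if "g \<in> carrier G" for g using that f component_carrier by blast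
  have n: "n \<in> nilradical R" unfolding n_def using nil T by (intro N.finsum_mem) auto
  then have nc: "n \<in> carrier R" using N.a_subset by blast
  \<comment> \<open>The identity of \<open>G\<close> need not lie in \<open>T\<close>; the component
    is then zero, and inserting the index changes nothing.\<close>
  have "e = (\<Oplus>\<^bsub>R\<^esub>g\<in>insert \<one>\<^bsub>G\<^esub> (T - {\<one>\<^bsub>G\<^esub>}). f g)"
    unfolding e using T f(2) fc by (intro R.add.finprod_mono_neutral_cong) auto
  also have "\<dots> = f \<one>\<^bsub>G\<^esub> \<oplus>\<^bsub>R\<^esub> n"
    unfolding n_def using T fc by (intro R.finsum_insert) auto
  finally have "f \<one>\<^bsub>G\<^esub> \<ominus>\<^bsub>R\<^esub> e = \<ominus>\<^bsub>R\<^esub> n"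
    using nc fc[of "\<one>\<^bsub>G\<^esub>"]
    by (simp add: a_minus_def R.minus_add R.a_assoc[symmetric] R.r_neg)
  then have "f \<one>\<^bsub>G\<^esub> \<ominus>\<^bsub>R\<^esub> e \<in> nilradical R" using n N.a_inv_closed by simp
  \<comment> \<open>Degree zero is closed under products, so \<open>A \<one>\<close> can play the
    part of \<open>S\<close> in the lifting of idempotents.\<close>
  moreover have "x \<otimes>\<^bsub>R\<^esub> y \<in> A \<one>\<^bsub>G\<^esub>" if "x \<in> A \<one>\<^bsub>G\<^esub>" "y \<in> A \<one>\<^bsub>G\<^esub>" for x y
    using mult_closed[of "\<one>\<^bsub>G\<^esub>" "\<one>\<^bsub>G\<^esub>"] that by simp
  ultimately show ?thesis
    using R.idempotent_mem_if_nilpotent_diff[OF component_subgroup[of "\<one>\<^bsub>G\<^esub>"]] f(1) assms(5,6)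
    by blast
qed

end
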